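(* Let $(\mathcal{C},F)$ be a generalized network code. For all $x_1,x_2\in\mathcal{C}$, we have $D_0(x_1,x_2)\ge D_2(x_1,x_2)$ and $D_1(x_1,x_2)\ge D_2(x_1,x_2)$. If moreover $F$ is an error-linear generalized network channel, then $D_0(x_1,x_2)=D_1(x_1,x_2)=D_2(x_1,x_2)$ for all $x_1,x_2\in\mathcal{C}$.
   Context: A generalized network channel consists of a set $\mathcal{C}$ of codewords, a set $\mathcal{E}$ of errors with a distinguished element $0$ (the zero error), an output set $\mathcal{Y}$, a weight $w:\mathcal{E}\to\mathbb{Z}_{\ge 0}$ with $w(z)=0$ if and only if $z=0$, and a transfer function $F:\mathcal{C}\times\mathcal{E}\to\mathcal{Y}$ such that $F(x,0)\ne F(x',0)$ whenever $x\neq x'$ in $\mathcal{C}$. The sets are otherwise arbitrary. The pair $(\mathcal{C},F)$ is called a generalized network code; $|\mathcal{C}|\ge 2$ is assumed. The channel $F$ is called error-linear if: (i) $\mathcal{E}$ is a (not necessarily abelian) group with operation $\circ$ and identity $0$; (ii) $\mathcal{Y}$ is an abelian group with operation $\oplus$ and identity $0$; (iii) $F(x,z)=f(x)\oplus h(z)$ for some function $f:\mathcal{C}\to\mathcal{Y}$ and some group homomorphism $h:\mathcal{E}\to\mathcal{Y}$; (iv) $w(z\circ z')\le w(z)+w(z')$ for all $z,z'\in\mathcal{E}$; (v) $w(z^{-1})=w(z)$ for all $z\in\mathcal{E}$; (vi) for every $z\in\mathcal{E}$ and integers $c_1,c_2\ge 0$ with $c_1+c_2=w(z)$ there exist $z_1,z_2\in\mathcal{E}$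 with $w(z_1)=c_1$, $w(z_2)=c_2$ and $z_1\circ z_2=z$. For $x\in\mathcal{C}$ and an integer $c\ge 0$, the decoding ball is $\Phi(x,c)=\{F(x,z): z\in\mathcal{E},\ w(z)\le c\}$. For $x_1,x_2\in\mathcal{C}$ (all $c$'s are nonnegative integers, and a minimum over the empty set is $+\infty$): $D_0(x_1,x_2)=\min\{c_1+c_2 : |c_1-c_2|\le 1,\ \Phi(x_1,c_1)\cap\Phi(x_2,c_2)\ne\emptyset\}$; $D_1(x_1,x_2)=\min\{c : \Phi(x_1,0)\cap\Phi(x_2,c)\neq\emptyset\}$; $D_2(x_1,x_2)=\min\{c_1+c_2 : \Phi(x_1,c_1)\cap\Phi(x_2,c_2)\neq\emptyset\}$. *)

theory Defs
  imports "HOL-Algebra.Group" "HOL-Library.Extended_Nat"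
begin

text \<open>
  The sets of codewords, errors and outputs are carrier sets, so that they are arbitrary
  and the groups of an error-linear channel can be those of HOL-Algebra.
\<close>

locale generalized_network_channel =
  fixes C :: "'c set" and E :: "'e set" and Y :: "'y set"
    and zero_error :: 'e
    and w :: "'e \<Rightarrow> nat"
    and F :: "'c \<Rightarrow> 'e \<Rightarrow> 'y"
  assumes zero_error_in: "zero_error \<in> E"
    and weight_eq_0_iff: "z \<in> E \<Longrightarrow> w z = 0 \<longleftrightarrow> z = zero_error"
    and transfer_in: "x \<in> C \<Longrightarrow> z \<in> E \<Longrightarrow> F x z \<in> Y"
    and transfer_zero_error_inj:
      "x \<in> C \<Longrightarrow> x' \<in> C \<Longrightarrow> x \<noteq> x' \<Longrightarrow> F x zero_error \<noteq> F x' zero_error"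

text \<open>
  The condition \<open>|C| \<ge> 2\<close> is not written with \<^const>\<open>card\<close>, which is 0 on infinite sets.
\<close>

locale generalized_network_code = generalized_network_channel +
  assumes two_codewords: "\<exists>x\<in>C. \<exists>x'\<in>C. x \<noteq> x'"

text \<open>
  \<open>G\<close> is the group of errors, not necessarily abelian, and \<open>H\<close> the abelian group of outputs;
  both are written multiplicatively.
\<close>

definition error_linear ::
  "'c set \<Rightarrow> 'e set \<Rightarrow> 'y set \<Rightarrow> 'e \<Rightarrow> ('e \<Rightarrow> nat) \<Rightarrow> ('c \<Rightarrow> 'e \<Rightarrow> 'y) \<Rightarrow> bool" where
  "error_linear C E Y zero_error w F \<longleftrightarrow>
    (\<exists>(G :: 'e monoid) (H :: 'y monoid) f h.
      group G \<and> carrier G = E \<and> \<one>\<^bsub>G\<^esub> = zero_error \<and>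
      comm_group H \<and> carrier H = Y \<and>
      f \<in> C \<rightarrow> Y \<and> h \<in> hom G H \<and>
      (\<forall>x\<in>C. \<forall>z\<in>E. F x z = f x \<otimes>\<^bsub>H\<^esub> h z) \<and>
      (\<forall>z\<in>E. \<forall>z'\<in>E. w (z \<otimes>\<^bsub>G\<^esub> z') \<le> w z + w z') \<and>
      (\<forall>z\<in>E. w (inv\<^bsub>G\<^esub> z) = w z) \<and>
      (\<forall>z\<in>E. \<forall>c1 c2. c1 + c2 = w z \<longrightarrow>
        (\<exists>z1\<in>E. \<exists>z2\<in>E. w z1 = c1 \<and> w z2 = c2 \<and> z1 \<otimes>\<^bsub>G\<^esub> z2 = z)))"

definition decoding_ball ::
  "'e set \<Rightarrow> ('e \<Rightarrow> nat) \<Rightarrow> ('c \<Rightarrow> 'e \<Rightarrow> 'y) \<Rightarrow> 'c \<Rightarrow> nat \<Rightarrow> 'y set" where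
  "decoding_ball E w F x c = {F x z | z. z \<in> E \<and> w z \<le> c}"

text \<open>
  The infimum in \<^typ>\<open>enat\<close> is attained on nonempty sets and is \<open>\<infinity>\<close> on the empty set.
\<close>

definition D0 ::
  "'e set \<Rightarrow> ('e \<Rightarrow> nat) \<Rightarrow> ('c \<Rightarrow> 'e \<Rightarrow> 'y) \<Rightarrow> 'c \<Rightarrow> 'c \<Rightarrow> enat" where
  "D0 E w F x1 x2 = Inf {enat (c1 + c2) | c1 c2.
     \<bar>int c1 - int c2\<bar> \<le> 1 \<and> decoding_ball E w F x1 c1 \<inter> decoding_ball E w F x2 c2 \<noteq> {}}"

definition D1 ::
  "'e set \<Rightarrow> ('e \<Rightarrow> nat) \<Rightarrow> ('c \<Rightarrow> 'e \<Rightarrow> 'y) \<Rightarrow> 'c \<Rightarrow> 'c \<Rightarrow> enat" where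
  "D1 E w F x1 x2 = Inf {enat c | c.
     decoding_ball E w F x1 0 \<inter> decoding_ball E w F x2 c \<noteq> {}}"

definition D2 ::
  "'e set \<Rightarrow> ('e \<Rightarrow> nat) \<Rightarrow> ('c \<Rightarrow> 'e \<Rightarrow> 'y) \<Rightarrow> 'c \<Rightarrow> 'c \<Rightarrow> enat" where
  "D2 E w F x1 x2 = Inf {enat (c1 + c2) | c1 c2.
     decoding_ball E w F x1 c1 \<inter> decoding_ball E w F x2 c2 \<noteq> {}}"

end

(*
  D0, D1 and D2 differ only in the pairs (c1, c2) over which c1 + c2 is minimised. In an
  error-linear channel, whether the balls of radii c1 and c2 meet depends on c1 + c2 alone:
  a common point f x1 + h z1 = f x2 + h z2 gives f x1 = f x2 + h z for z = z2 z1^-1, of weight at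
  most c1 + c2, and z can be split as u v with the weight distributed as one likes, so that
  f x1 + h (v^-1) = f x2 + h u.
*)
theory Submission imports Defs begin

lemma decoding_balls_meet_iff:
  "decoding_ball E w F x1 c1 \<inter> decoding_ball E w F x2 c2 \<noteq> {} \<longleftrightarrow>
    (\<exists>z1\<in>E. \<exists>z2\<in>E. w z1 \<le> c1 \<and> w z2 \<le> c2 \<and> F x1 z1 = F x2 z2)"
  unfolding decoding_ball_def by fastforce

lemma decoding_balls_meet_transfer:
  fixes C :: "'c set" and E :: "'e set" and Y :: "'y set"
  assumes lin: "error_linear C E Y zero_error w F"
    and x: "x1 \<in> C" "x2 \<in> C"
    and sum: "a + b = c1 + c2"
    and meet: "decoding_ball E w F x1 c1 \<inter> decoding_ball E w F x2 c2 \<noteq> {}"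
  shows "decoding_ball E w F x1 a \<inter> decoding_ball E w F x2 b \<noteq> {}"
proof -
  obtain G :: "'e monoid" and H :: "'y monoid" and f h where
    G: "group G" and E: "carrier G = E" and H: "comm_group H" and Y: "carrier H = Y"
    and f: "f \<in> C \<rightarrow> Y" and h: "h \<in> hom G H"
    and F_all: "\<forall>x\<in>C. \<forall>z\<in>E. F x z = f x \<otimes>\<^bsub>H\<^esub> h z"
    and w_mult_all: "\<forall>z\<in>E. \<forall>z'\<in>E. w (z \<otimes>\<^bsub>G\<^esub> z') \<le> w z + w z'"
    and w_inv_all: "\<forall>z\<in>E. w (inv\<^bsub>G\<^esub> z) = w z"
    and split_all: "\<forall>z\<in>E. \<forall>c1 c2. c1 + c2 = w z \<longrightarrow>
        (\<exists>z1\<in>E. \<exists>z2\<in>E. w z1 = c1 \<and> w z2 = c2 \<and> z1 \<otimes>\<^bsub>G\<^esub> z2 = z)"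
    using lin unfolding error_linear_def by (elim exE conjE) (rule that)
  note F = F_all[rule_format] and w_mult = w_mult_all[rule_format]
    and w_inv = w_inv_all[rule_format] and split = split_all[rule_format]
  interpret G: group G by fact
  interpret H: comm_group H by fact
  interpret hom: group_hom G H h
    using h by unfold_locales
  obtain z1 z2 where z: "z1 \<in> E" "z2 \<in> E" "w z1 \<le> c1" "w z2 \<le> c2" "F x1 z1 = F x2 z2"
    using meet unfolding decoding_balls_meet_iff by blast
  define z where "z = z2 \<otimes>\<^bsub>G\<^esub> inv\<^bsub>G\<^esub> z1"
  have zE: "z \<in> E" and wz: "w z \<le> a + b"
    using z w_mult[of z2 "inv\<^bsub>G\<^esub> z1"] w_inv[of z1] sum unfolding z_def E[symmetric] by auto
  \<comment> \<open>The weight of \<open>z\<close> may fall short of \<open>a + b\<close>, and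
    splitting needs parts that sum exactly to \<open>w z\<close>. So \<open>u\<close> takes as much
    as the radius \<open>b\<close> allows, and \<open>v\<close> the rest, which is at most
    \<open>a\<close> because \<open>w z \<le> a + b\<close>; if \<open>w z \<le> b\<close>, the rest
    is 0.\<close>
  obtain u v where uv: "u \<in> E" "v \<in> E" "w u = min b (w z)" "w v = w z - min b (w z)"
    "u \<otimes>\<^bsub>G\<^esub> v = z"
    using split[OF zE, of "min b (w z)" "w z - min b (w z)"] by auto
  have carr: "f x1 \<in> carrier H" "f x2 \<in> carrier H" "h z1 \<in> carrier H" "h z2 \<in> carrier H"
    "h u \<in> carrier H" "h v \<in> carrier H"
    using f x z uv Y E by auto
  \<comment> \<open>Both sides equal \<open>h z\<close>, computed from the two factorizations of
    \<open>z\<close>.\<close>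
  have hz: "h u \<otimes>\<^bsub>H\<^esub> h v = h z2 \<otimes>\<^bsub>H\<^esub> inv\<^bsub>H\<^esub> h z1"
    using uv z E hom.hom_mult[of u v] hom.hom_mult[of z2 "inv\<^bsub>G\<^esub> z1"]
      hom.hom_inv[of z1] G.inv_closed[of z1] by (auto simp: z_def)
  have "f x1 = f x2 \<otimes>\<^bsub>H\<^esub> h z2 \<otimes>\<^bsub>H\<^esub> inv\<^bsub>H\<^esub> h z1"
    using z x F carr by (metis H.inv_solve_right H.m_closed)
  also have "\<dots> = f x2 \<otimes>\<^bsub>H\<^esub> h u \<otimes>\<^bsub>H\<^esub> h v"
    using carr hz by (simp add: H.m_assoc)
  \<comment> \<open>The remainder \<open>v\<close> changes sides and so becomes an error at
    \<open>x1\<close>, namely its inverse, which has the same weight.\<close>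
  finally have "f x1 \<otimes>\<^bsub>H\<^esub> inv\<^bsub>H\<^esub> h v = f x2 \<otimes>\<^bsub>H\<^esub> h u"
    using carr by (metis H.inv_solve_right' H.m_closed)
  then have "F x1 (inv\<^bsub>G\<^esub> v) = F x2 u"
    using F x uv E G.inv_closed by (metis hom.hom_inv)
  moreover have "inv\<^bsub>G\<^esub> v \<in> E" "w (inv\<^bsub>G\<^esub> v) \<le> a" "w u \<le> b"
    using uv w_inv wz E by auto
  ultimately show ?thesis
    unfolding decoding_balls_meet_iff using uv by blast
qed

lemma D2_le_D0: "D2 E w F x1 x2 \<le> D0 E w F x1 x2"
  unfolding D2_def D0_def by (rule Inf_superset_mono) blast

lemma D2_le_D1: "D2 E w F x1 x2 \<le> D1 E w F x1 x2"
  unfolding D2_def D1_def by (rule Inf_superset_mono) force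

lemma D0_le_D2:
  assumes "error_linear C E Y zero_error w F" "x1 \<in> C" "x2 \<in> C"
  shows "D0 E w F x1 x2 \<le> D2 E w F x1 x2"
  unfolding D2_def
proof (rule Inf_greatest, clarify)
  fix c1 c2
  assume meet: "decoding_ball E w F x1 c1 \<inter> decoding_ball E w F x2 c2 \<noteq> {}"
  \<comment> \<open>Halving with rounding down: \<open>b\<close> equals \<open>a\<close> or
    \<open>a + 1\<close>, according to the parity of the sum.\<close>
  define a where "a = (c1 + c2) div 2"
  define b where "b = c1 + c2 - a"
  have ab: "a + b = c1 + c2" "\<bar>int a - int b\<bar> \<le> 1"
    unfolding a_def b_def by presburger+
  then show "D0 E w F x1 x2 \<le> enat (c1 + c2)"
    using decoding_balls_meet_transfer[OF assms ab(1) meet] unfolding D0_def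
    by (intro Inf_lower CollectI exI[of _ a] exI[of _ b]) simp
qed

text \<open>The whole radius is shifted to \<open>x2\<close>, so that the radius at
  \<open>x1\<close> becomes 0 and the sum is unchanged.\<close>

lemma D1_le_D2:
  assumes "error_linear C E Y zero_error w F" "x1 \<in> C" "x2 \<in> C"
  shows "D1 E w F x1 x2 \<le> D2 E w F x1 x2"
  unfolding D2_def
proof (rule Inf_greatest, clarify)
  fix c1 c2
  assume "decoding_ball E w F x1 c1 \<inter> decoding_ball E w F x2 c2 \<noteq> {}"
  then show "D1 E w F x1 x2 \<le> enat (c1 + c2)"
    using decoding_balls_meet_transfer[OF assms, of 0 "c1 + c2" c1 c2] unfolding D1_def
    by (intro Inf_lower) auto
qed

theorem theorem5p5:
  fixes C :: "'c set" and E :: "'e set" and Y :: "'y set"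
    and zero_error :: 'e
    and w :: "'e \<Rightarrow> nat"
    and F :: "'c \<Rightarrow> 'e \<Rightarrow> 'y"
  assumes "generalized_network_code C E Y zero_error w F"
  shows "(\<forall>x1\<in>C. \<forall>x2\<in>C. D0 E w F x1 x2 \<ge> D2 E w F x1 x2 \<and> D1 E w F x1 x2 \<ge> D2 E w F x1 x2) \<and>
    (error_linear C E Y zero_error w F \<longrightarrow>
      (\<forall>x1\<in>C. \<forall>x2\<in>C. D0 E w F x1 x2 = D1 E w F x1 x2 \<and> D1 E w F x1 x2 = D2 E w F x1 x2))"
proof (intro conjI impI ballI)
  fix x1 x2
  assume lin: "error_linear C E Y zero_error w F" and x: "x1 \<in> C" "x2 \<in> C"
  show D1: "D1 E w F x1 x2 = D2 E w F x1 x2"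
    using D1_le_D2[OF lin x] D2_le_D1 by (rule antisym)
  show "D0 E w F x1 x2 = D1 E w F x1 x2"
    unfolding D1 using D0_le_D2[OF lin x] D2_le_D0 by (rule antisym)
qed (rule D2_le_D0 D2_le_D1)+

end
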